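(* Let $\mathcal{R}$ be a finite valuation ring of order $q^r$, and let $F,G\subseteq\mathcal{R}^d$ with $F\cap(\mathcal{R}^0)^d=\emptyset$. For $t\in\mathcal{R}$ let \[\nu(t)=|\{(\mathbf{x},\mathbf{y})\in F\times G\colon \mathbf{x}\cdot\mathbf{y}=t\}|.\] Then \[\sum_{t\in\mathcal{R}}\nu(t)^2\le\frac{|F|^2|G|^2}{q^r}+q^{(d-1)(2r-1)}|F||G|\cdot\max_{\mathbf{x}\in\mathcal{R}^d\setminus(\mathcal{R}^0)^d}|F\cap l_{\mathbf{x}}|,\] where $l_{\mathbf{x}}=\{s\mathbf{x}\colon s\in\mathcal{R}^*\}$.
   Context: $\mathcal{R}$ is a finite valuation ring: a finite commutative local ring with identity whose ideals are totally ordered by inclusion (a finite chain ring); its residue field has $q$ elements, $q$ an odd prime power, and $|\mathcal{R}|=q^r$. $\mathcal{R}^*$ denotes the units and $\mathcal{R}^0$ the non-units of $\mathcal{R}$. For $\mathbf{x},\mathbf{y}\in\mathcal{R}^d$, $\mathbf{x}\cdot\mathbf{y}=x_1y_1+\cdots+x_dy_d$. *)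

theory Defs
  imports "HOL-Analysis.Finite_Cartesian_Product" "HOL-Analysis.Cartesian_Space"
    "HOL-Number_Theory.Prime_Powers"
begin

context comm_ring_1
begin

definition is_ideal :: "'a set \<Rightarrow> bool" where
  "is_ideal I \<longleftrightarrow>
     0 \<in> I \<and> (\<forall>x\<in>I. \<forall>y\<in>I. x + y \<in> I) \<and> (\<forall>a. \<forall>x\<in>I. a * x \<in> I)"

definition is_maximal_ideal :: "'a set \<Rightarrow> bool" where
  "is_maximal_ideal M \<longleftrightarrow>
     is_ideal M \<and> M \<noteq> UNIV \<and> (\<forall>I. is_ideal I \<and> M \<subseteq> I \<longrightarrow> I = M \<or> I = UNIV)"

end

class finite_valuation_ring = comm_ring_1 + finite +
  assumes local_ring: "\<exists>!M. is_maximal_ideal M"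
    and ideals_chain: "\<And>I J. is_ideal I \<Longrightarrow> is_ideal J \<Longrightarrow> I \<subseteq> J \<or> J \<subseteq> I"

text \<open>The underlying set of the residue field: the cosets of the unique maximal ideal.\<close>

definition residue_field :: "'a::finite_valuation_ring set set" where
  "residue_field = UNIV // {(x, y). x - y \<in> (THE M. is_maximal_ideal M)}"

definition units :: "'a::comm_ring_1 set" where
  "units = {s. s dvd 1}"

definition nonunits :: "'a::comm_ring_1 set" where
  "nonunits = - units"

text \<open>The set \<open>(R\<^sup>0)\<^sup>d\<close> of vectors all of whose coordinates are non-units.\<close>

definition nonunit_vectors :: "('a::comm_ring_1 ^ 'd) set" where
  "nonunit_vectors = {x. \<forall>i. x $ i \<in> nonunits}"

definition dot_prod :: "'a::comm_ring_1 ^ 'd::finite \<Rightarrow> 'a ^ 'd \<Rightarrow> 'a" where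
  "dot_prod x y = (\<Sum>i\<in>UNIV. x $ i * y $ i)"

definition unit_line :: "'a::comm_ring_1 ^ 'd \<Rightarrow> ('a ^ 'd) set" where
  "unit_line x = {s *s x | s. s \<in> units}"

definition nu :: "('a::comm_ring_1 ^ 'd::finite) set \<Rightarrow> ('a ^ 'd) set \<Rightarrow> 'a \<Rightarrow> nat" where
  "nu F G t = card {(x, y). (x, y) \<in> F \<times> G \<and> dot_prod x y = t}"

end

theory Submission
  imports Defs "HOL-Analysis.Convex"
begin

text \<open>
  Let \<open>n\<^sub>x(t)\<close> count the \<open>y \<in> G\<close> with \<open>x \<cdot> y = t\<close>, and let \<open>g\<^sub>x = n\<^sub>x - |G| / |R|\<close>, which sums to zero
  over \<open>R\<close>. By Cauchy-Schwarz the excess of the second moment of \<open>\<nu>\<close> over its main term is at most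
  \<open>|F| A\<close>, where \<open>A\<close> is the sum of all \<open>g\<^sub>x(t)\<^sup>2\<close>. On the other hand \<open>A\<close> is the sum over \<open>y \<in> G\<close> of
  \<open>\<Sum>\<^sub>x g\<^sub>x(x \<cdot> y)\<close>, so applying Cauchy-Schwarz again and extending \<open>y\<close> to the whole module bounds \<open>A\<^sup>2\<close>
  by \<open>|G|\<close> times the sum over \<open>x, x'\<close> of the correlations \<open>\<Sum>\<^sub>y g\<^sub>x(x \<cdot> y) g\<^sub>x\<^sub>'(x' \<cdot> y)\<close>. If some
  \<open>2 \<times> 2\<close> minor of \<open>(x, x')\<close> is a unit, then \<open>y \<mapsto> (x \<cdot> y, x' \<cdot> y)\<close> is surjective and the correlation
  vanishes; otherwise AM-GM bounds it by \<open>|R|\<^bsup>d-1\<^esup>\<close> times the mean of the two square sums. The vectors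
  \<open>x'\<close> proportional to \<open>x\<close> modulo the maximal ideal lie on at most \<open>q\<^bsup>(r-1)(d-1)\<^esup>\<close> unit lines, which
  yields \<open>A \<le> |G| q\<^bsup>(d-1)(2r-1)\<^esup> max |F \<inter> l\<^sub>x|\<close>.
\<close>

section \<open>Units, non-units and the residue field\<close>

lemma mult_in_units_iff: "a * b \<in> units \<longleftrightarrow> a \<in> units \<and> b \<in> units"
  for a b :: "'a::comm_ring_1"
  unfolding units_def mem_Collect_eq
  by (metis dvd_mult_left dvd_mult_right mult_dvd_mono mult_1)

lemma one_in_units: "(1::'a::comm_ring_1) \<in> units"
  by (simp add: units_def)

lemma mult_nonunits: "b \<in> nonunits \<Longrightarrow> a * b \<in> nonunits"
  for a b :: "'a::comm_ring_1"
  by (simp add: nonunits_def mult_in_units_iff)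

lemma is_ideal_principal: "is_ideal (range ((*) a))"
  for a :: "'a::comm_ring_1"
  unfolding is_ideal_def
proof (intro conjI ballI allI)
  show "0 \<in> range ((*) a)" by (rule range_eqI[of _ _ 0]) simp
next
  fix x y assume "x \<in> range ((*) a)" "y \<in> range ((*) a)"
  then obtain b c where "x = a * b" "y = a * c" by blast
  then show "x + y \<in> range ((*) a)"
    by (intro range_eqI[of _ _ "b + c"]) (simp add: distrib_left)
next
  fix k x assume "x \<in> range ((*) a)"
  then obtain b where "x = a * b" by blast
  then show "k * x \<in> range ((*) a)"
    by (intro range_eqI[of _ _ "k * b"]) (simp add: mult.left_commute)
qed

text \<open>Of two principal ideals one contains the other, so one of \<open>a\<close>,
  \<open>b\<close> divides the other and hence also the sum; a multiple of a non-unit is a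
  non-unit.\<close>

lemma add_nonunits:
  fixes a b :: "'a::finite_valuation_ring"
  assumes "a \<in> nonunits" "b \<in> nonunits"
  shows "a + b \<in> nonunits"
proof -
  have a: "a \<in> range ((*) a)" and b: "b \<in> range ((*) b)"
    by (rule range_eqI[of _ _ 1], simp)+
  have "range ((*) a) \<subseteq> range ((*) b) \<or> range ((*) b) \<subseteq> range ((*) a)"
    by (intro ideals_chain is_ideal_principal)
  then show ?thesis
  proof
    assume "range ((*) a) \<subseteq> range ((*) b)"
    then obtain c where "a = b * c" using a by blast
    then have "a + b = (c + 1) * b" by (simp add: algebra_simps)
    then show ?thesis using mult_nonunits[OF assms(2)] by simp
  next
    assume "range ((*) b) \<subseteq> range ((*) a)"
    then obtain c where "b = a * c" using b by blast
    then have "a + b = (c + 1) * a" by (simp add: algebra_simps)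
    then show ?thesis using mult_nonunits[OF assms(1)] by simp
  qed
qed

lemma zero_nonunits: "(0::'a::comm_ring_1) \<in> nonunits"
  by (simp add: nonunits_def units_def)

text \<open>A larger ideal would contain a unit. By uniqueness this identifies the
  \<open>THE\<close> in \<open>residue_field\<close> with \<open>nonunits\<close>.\<close>

lemma is_maximal_ideal_nonunits: "is_maximal_ideal (nonunits :: 'a::finite_valuation_ring set)"
  unfolding is_maximal_ideal_def
proof (intro conjI allI impI)
  show "is_ideal (nonunits :: 'a set)"
    unfolding is_ideal_def using zero_nonunits add_nonunits mult_nonunits by blast
  show "(nonunits :: 'a set) \<noteq> UNIV"
    using one_in_units by (auto simp: nonunits_def)
next
  fix I :: "'a set" assume I: "is_ideal I \<and> nonunits \<subseteq> I"
  show "I = nonunits \<or> I = UNIV"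
  proof (cases "I = nonunits")
    case False
    then obtain u where u: "u \<in> I" "u \<in> units" using I by (auto simp: nonunits_def)
    then obtain v where v: "1 = u * v" by (auto simp: units_def elim: dvdE)
    have "a \<in> I" for a
    proof -
      have "(a * v) * u \<in> I" using I u unfolding is_ideal_def by blast
      moreover have "(a * v) * u = a" using v by (simp add: mult.assoc mult.commute[of v u])
      ultimately show ?thesis by simp
    qed
    then show ?thesis by blast
  qed simp
qed

text \<open>Lagrange's count for the additive group: each residue class is a translate of
  \<open>nonunits\<close>. It turns the size of the residue field into the number of
  non-units.\<close>

lemma card_eq_residue_mult_nonunits:
  "CARD('a::finite_valuation_ring) = card (residue_field :: 'a set set) * card (nonunits :: 'a set)"
proof -
  define E where "E = {(x, y :: 'a). x - y \<in> nonunits}"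
  have the: "(THE M. is_maximal_ideal M) = (nonunits :: 'a set)"
    using local_ring is_maximal_ideal_nonunits by (intro the1_equality)
  have neg: "- a \<in> nonunits" if "a \<in> nonunits" for a :: 'a
    using mult_nonunits[OF that, of "-1"] by simp
  have E: "equiv UNIV E"
  proof (rule equivI)
    show "refl E" by (auto simp: refl_on_def E_def zero_nonunits)
    show "sym E" using neg by (fastforce simp: sym_def E_def)
    show "trans E"
      unfolding trans_def E_def using add_nonunits by (fastforce simp: algebra_simps)
  qed (simp add: E_def)
  have "card c = card (nonunits :: 'a set)" if "c \<in> UNIV // E" for c
  proof -
    obtain x where x: "c = E `` {x}" using \<open>c \<in> UNIV // E\<close> by (auto simp: quotient_def)
    have "c = (\<lambda>a. x - a) ` nonunits"
    proof (rule set_eqI)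
      fix y
      have "y = x - (x - y)" by simp
      then show "y \<in> c \<longleftrightarrow> y \<in> (\<lambda>a. x - a) ` nonunits"
        unfolding x E_def by (auto intro: image_eqI[of _ _ "x - y"])
    qed
    then show ?thesis by (simp add: card_image inj_on_def)
  qed
  then have "card (nonunits :: 'a set) * card (UNIV // E) = card (\<Union>(UNIV // E))"
    using quotient_disj[OF E] by (intro card_partition) auto
  then show ?thesis
    using Union_quotient[OF E] by (simp add: residue_field_def the E_def mult.commute)
qed

section \<open>Sums of functions of dot products\<close>

lemma dot_prod_add: "dot_prod x (y + z) = dot_prod x y + dot_prod x z"
  by (simp add: dot_prod_def distrib_left sum.distrib)

lemma dot_prod_axis: "dot_prod x (axis i a) = x $ i * a"
  by (simp add: dot_prod_def axis_def if_distrib[of "(*) _"] cong: if_cong)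

lemma sum_surj_additive:
  fixes h :: "'b::{finite,ab_group_add} \<Rightarrow> real" and \<phi> :: "'c::{finite,ab_group_add} \<Rightarrow> 'b"
  assumes add: "\<And>y z. \<phi> (y + z) = \<phi> y + \<phi> z" and surj: "\<And>b. \<exists>y. \<phi> y = b"
  shows "real CARD('b) * (\<Sum>y\<in>UNIV. h (\<phi> y)) = real CARD('c) * (\<Sum>b\<in>UNIV. h b)"
proof -
  have shift: "(\<Sum>y\<in>UNIV. h (\<phi> y)) = (\<Sum>y\<in>UNIV. h (\<phi> y + b))" for b
  proof -
    obtain z where z: "\<phi> z = b" using surj by blast
    have "(\<Sum>y\<in>UNIV. h (\<phi> (y + z))) = (\<Sum>y\<in>UNIV. h (\<phi> y))"
      by (rule sum.reindex_bij_witness[of _ "\<lambda>y. y - z" "\<lambda>y. y + z"]) auto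
    then show ?thesis by (simp add: add z)
  qed
  have "real CARD('b) * (\<Sum>y\<in>UNIV. h (\<phi> y)) = (\<Sum>b\<in>(UNIV::'b set). \<Sum>y\<in>UNIV. h (\<phi> y))"
    by simp
  also have "\<dots> = (\<Sum>b\<in>UNIV. \<Sum>y\<in>UNIV. h (\<phi> y + b))"
    by (rule sum.cong[OF refl]) (rule shift)
  also have "\<dots> = (\<Sum>y\<in>UNIV. \<Sum>b\<in>UNIV. h (\<phi> y + b))"
    by (rule sum.swap)
  also have "\<dots> = (\<Sum>y\<in>(UNIV::'c set). \<Sum>b\<in>UNIV. h b)"
  proof (rule sum.cong[OF refl])
    fix y
    show "(\<Sum>b\<in>UNIV. h (\<phi> y + b)) = (\<Sum>b\<in>UNIV. h b)"
      by (rule sum.reindex_bij_witness[of _ "\<lambda>b. b - \<phi> y" "\<lambda>b. \<phi> y + b"]) auto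
  qed
  finally show ?thesis by simp
qed

lemma sum_dot_prod:
  fixes x :: "'a::{comm_ring_1,finite} ^ 'd::finite" and h :: "'a \<Rightarrow> real"
  assumes "x $ j \<in> units"
  shows "(\<Sum>y\<in>UNIV. h (dot_prod x y)) = real CARD('a) ^ (CARD('d) - 1) * (\<Sum>t\<in>UNIV. h t)"
proof -
  obtain v where v: "1 = x $ j * v" using assms by (auto simp: units_def elim: dvdE)
  have "dot_prod x (axis j (v * b)) = b" for b
    using v by (simp add: dot_prod_axis flip: mult.assoc)
  then have "real CARD('a) * (\<Sum>y\<in>UNIV. h (dot_prod x y))
      = real CARD('a ^ 'd) * (\<Sum>t\<in>UNIV. h t)"
    by (intro sum_surj_additive dot_prod_add) blast
  moreover have "real CARD('a ^ 'd) = real CARD('a) * real CARD('a) ^ (CARD('d) - 1)"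
    by (simp flip: power_Suc)
  ultimately show ?thesis by simp
qed

section \<open>Linear dependence modulo the maximal ideal, via 2 x 2 minors\<close>

definition minors_nonunit :: "'a::comm_ring_1 ^ 'd \<Rightarrow> 'a ^ 'd \<Rightarrow> bool" where
  "minors_nonunit x x' \<longleftrightarrow> (\<forall>i j. x $ i * x' $ j - x $ j * x' $ i \<in> nonunits)"

lemma minors_nonunit_commute: "minors_nonunit x x' \<longleftrightarrow> minors_nonunit x' x"
  unfolding minors_nonunit_def by (metis mult.commute)

text \<open>The pair of dot products is equidistributed on the square of the ring, so the
  correlation is a multiple of the product of the sums of \<open>h\<close> and
  \<open>k\<close>.\<close>

lemma dot_prod_correlation_zero:
  fixes x x' :: "'a::{comm_ring_1,finite} ^ 'd::finite" and h k :: "'a \<Rightarrow> real"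
  assumes "\<not> minors_nonunit x x'" "(\<Sum>t\<in>UNIV. h t) = 0"
  shows "(\<Sum>y\<in>UNIV. h (dot_prod x y) * k (dot_prod x' y)) = 0"
proof -
  obtain i j where "x $ i * x' $ j - x $ j * x' $ i \<in> units"
    using assms(1) by (auto simp: minors_nonunit_def nonunits_def)
  then obtain v where v: "1 = (x $ i * x' $ j - x $ j * x' $ i) * v"
    by (auto simp: units_def elim: dvdE)
  define \<phi> where "\<phi> y = (dot_prod x y, dot_prod x' y)" for y
  have "\<exists>y. \<phi> y = b" for b
  proof -
    obtain s t where b: "b = (s, t)" by force
    \<comment> \<open>Cramer's rule for the coordinates \<open>i\<close> and \<open>j\<close>, with
      \<open>v\<close> the inverse of the minor.\<close>
    let ?y = "axis i (v * (x' $ j * s - x $ j * t)) + axis j (v * (x $ i * t - x' $ i * s))"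
    have "dot_prod x ?y = ((x $ i * x' $ j - x $ j * x' $ i) * v) * s"
      "dot_prod x' ?y = ((x $ i * x' $ j - x $ j * x' $ i) * v) * t"
      by (simp_all add: dot_prod_add dot_prod_axis algebra_simps)
    then show ?thesis unfolding \<phi>_def b using v by (metis mult_1)
  qed
  then have "real CARD('a \<times> 'a) * (\<Sum>y\<in>UNIV. (\<lambda>(s, t). h s * k t) (\<phi> y))
      = real CARD('a ^ 'd) * (\<Sum>b\<in>UNIV. (\<lambda>(s, t). h s * k t) b)"
    by (intro sum_surj_additive) (simp_all add: \<phi>_def dot_prod_add)
  moreover have "(\<Sum>b\<in>UNIV. (\<lambda>(s, t). h s * k t) b) = (\<Sum>s\<in>UNIV. h s) * (\<Sum>t\<in>UNIV. k t)"
    by (simp add: sum_product sum.cartesian_product)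
  ultimately show ?thesis using assms(2) by (simp add: \<phi>_def)
qed

text \<open>Scaling \<open>x'\<close> to have coordinate 1 at a place \<open>j\<close> where
  \<open>x\<close> has a unit gives a vector congruent to a fixed multiple of \<open>x\<close>. Its
  other d-1 coordinates each range over one coset of the non-units, and each such vector accounts
  for a single unit line.\<close>

lemma card_minors_nonunit_le:
  fixes F :: "('a::finite_valuation_ring ^ 'd::finite) set"
  assumes "F \<inter> nonunit_vectors = {}" "x \<in> F"
  shows "card {x' \<in> F. minors_nonunit x x'}
    \<le> card (nonunits :: 'a set) ^ (CARD('d) - 1)
        * (MAX x\<in>UNIV - nonunit_vectors. card (F \<inter> unit_line x))"
proof -
  let ?M = "MAX x\<in>UNIV - nonunit_vectors. card (F \<inter> unit_line x)"
  obtain j where j: "x $ j \<in> units"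
    using assms by (auto simp: nonunit_vectors_def nonunits_def)
  then obtain c where c: "1 = x $ j * c" by (auto simp: units_def elim: dvdE)
  define P where "P = {p :: 'a ^ 'd. p $ j = 1 \<and> (\<forall>i. p $ i - c * x $ i \<in> nonunits)}"
  have P_le: "card P \<le> card (nonunits :: 'a set) ^ (CARD('d) - 1)"
  proof -
    \<comment> \<open>Coordinate \<open>j\<close> is fixed to 1 on \<open>P\<close>, so dropping it
      loses nothing; this is why the exponent is d-1.\<close>
    define e where "e p = (\<lambda>i\<in>UNIV - {j}. p $ i - c * x $ i)" for p :: "'a ^ 'd"
    have "inj_on e P"
    proof (rule inj_onI)
      fix p p' assume p: "p \<in> P" "p' \<in> P" "e p = e p'"
      have "p $ i = p' $ i" for i
      proof (cases "i = j")
        case False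
        then show ?thesis using fun_cong[OF p(3), of i] by (simp add: e_def)
      qed (use p in \<open>simp add: P_def\<close>)
      then show "p = p'" by (simp add: vec_eq_iff)
    qed
    moreover have "e ` P \<subseteq> PiE (UNIV - {j}) (\<lambda>_. nonunits)"
      by (rule image_subsetI) (simp add: e_def P_def PiE_iff)
    ultimately have "card P \<le> card (PiE (UNIV - {j}) (\<lambda>_. nonunits :: 'a set))"
      by (intro card_inj_on_le) (auto intro: finite_PiE)
    then show ?thesis by (simp add: card_PiE)
  qed
  have line_le: "card (F \<inter> unit_line p) \<le> ?M" if "p \<in> P" for p
  proof -
    have "p \<notin> nonunit_vectors"
      using that one_in_units by (auto simp: P_def nonunit_vectors_def nonunits_def intro!: exI[of _ j])
    then show ?thesis by (intro Max_ge) auto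
  qed
  have "{x' \<in> F. minors_nonunit x x'} \<subseteq> (\<Union>p\<in>P. F \<inter> unit_line p)"
  proof
    fix x' assume "x' \<in> {x' \<in> F. minors_nonunit x x'}"
    then have x': "x' \<in> F" and minor: "\<And>i j. x $ i * x' $ j - x $ j * x' $ i \<in> nonunits"
      by (auto simp: minors_nonunit_def)
    \<comment> \<open>Otherwise the minors with column \<open>j\<close> force every coordinate of
      \<open>x'\<close> to be a non-unit, which is excluded on \<open>F\<close>.\<close>
    have "x' $ j \<in> units"
    proof (rule ccontr)
      assume "x' $ j \<notin> units"
      then have nj: "x' $ j \<in> nonunits" by (simp add: nonunits_def)
      have "x' $ i \<in> nonunits" for i
      proof -
        have "x $ i * x' $ j + (x $ j * x' $ i - x $ i * x' $ j) \<in> nonunits"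
          using minor[of j i] nj by (intro add_nonunits mult_nonunits) auto
        then show ?thesis using j by (simp add: nonunits_def mult_in_units_iff)
      qed
      then show False using x' assms(1) by (auto simp: nonunit_vectors_def)
    qed
    then obtain c' where c': "1 = x' $ j * c'" by (auto simp: units_def elim: dvdE)
    define p where "p = c' *s x'"
    have "p $ i - c * x $ i \<in> nonunits" for i
    proof -
      \<comment> \<open>Inserting 1 in the form \<open>x $ j * c\<close> and
        \<open>x' $ j * c'\<close> exhibits the difference as a multiple of a minor.\<close>
      have "p $ i - c * x $ i = (x $ j * c) * (c' * x' $ i) - (x' $ j * c') * (c * x $ i)"
        by (simp add: p_def flip: c c')
      also have "\<dots> = (c * c') * (x $ j * x' $ i - x $ i * x' $ j)"
        by (simp add: algebra_simps)
      finally show ?thesis using mult_nonunits[OF minor] by simp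
    qed
    then have "p \<in> P" using c' by (simp add: P_def p_def mult.commute)
    moreover have "x' \<in> unit_line p"
    proof -
      have "x' = x' $ j *s p" by (simp add: p_def vector_smult_assoc flip: c')
      then show ?thesis using \<open>x' $ j \<in> units\<close> unfolding unit_line_def by blast
    qed
    ultimately show "x' \<in> (\<Union>p\<in>P. F \<inter> unit_line p)" using x' by blast
  qed
  then have "card {x' \<in> F. minors_nonunit x x'} \<le> card (\<Union>p\<in>P. F \<inter> unit_line p)"
    by (intro card_mono) auto
  also have "\<dots> \<le> (\<Sum>p\<in>P. card (F \<inter> unit_line p))"
    by (rule card_UN_le) simp
  also have "\<dots> \<le> card P * ?M"
    using sum_bounded_above[of P "\<lambda>p. card (F \<inter> unit_line p)" ?M] line_le by simp
  also have "\<dots> \<le> card (nonunits :: 'a set) ^ (CARD('d) - 1) * ?M"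
    using P_le by (rule mult_le_mono1)
  finally show ?thesis .
qed

section \<open>The second moment, given a bound on the number of dependent vectors\<close>

lemma sum_nu_sq_le:
  fixes F G :: "('a::{comm_ring_1,finite} ^ 'd::finite) set" and K :: real
  assumes F: "F \<inter> nonunit_vectors = {}"
    and K: "\<And>x. x \<in> F \<Longrightarrow> real (card {x' \<in> F. minors_nonunit x x'}) \<le> K"
  shows "(\<Sum>t\<in>UNIV. (real (nu F G t))\<^sup>2)
    \<le> (real (card F))\<^sup>2 * (real (card G))\<^sup>2 / real CARD('a)
      + real (card F) * real (card G) * real CARD('a) ^ (CARD('d) - 1) * K"
\<comment> \<open>For empty \<open>F\<close> the hypothesis on \<open>K\<close> is vacuous; a member
  of \<open>F\<close> is what yields \<open>K \<ge> 0\<close>.\<close>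
proof (cases "F = {}")
  case True
  then show ?thesis by (simp add: nu_def)
next
  case False
  let ?N = "real CARD('a)"
  define n where "n x t = real (card {y \<in> G. dot_prod x y = t})" for x t
  define g where "g x t = n x t - real (card G) / ?N" for x t
  define s where "s x = (\<Sum>t\<in>UNIV. (g x t)\<^sup>2)" for x
  define A where "A = (\<Sum>x\<in>F. s x)"
  define Q where "Q = ?N ^ (CARD('d) - 1)"
  have N0: "?N > 0" by simp
  have K0: "K \<ge> 0"
    using False K by (meson all_not_in_conv of_nat_0_le_iff order_trans)
  have n_sum: "(\<Sum>t\<in>UNIV. h t * n x t) = (\<Sum>y\<in>G. h (dot_prod x y))" for x and h :: "'a \<Rightarrow> real"
  proof -
    have "(\<Sum>y\<in>G. h (dot_prod x y))
        = (\<Sum>t\<in>UNIV. \<Sum>y\<in>{y \<in> G. dot_prod x y = t}. h (dot_prod x y))"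
      by (rule sum.group[symmetric]) auto
    also have "\<dots> = (\<Sum>t\<in>UNIV. h t * n x t)"
      by (intro sum.cong) (auto simp: n_def mult.commute)
    finally show ?thesis by simp
  qed
  have nu_eq: "real (nu F G t) = (\<Sum>x\<in>F. n x t)" for t
  proof -
    have "{(x, y). (x, y) \<in> F \<times> G \<and> dot_prod x y = t} = Sigma F (\<lambda>x. {y \<in> G. dot_prod x y = t})"
      by auto
    then show ?thesis by (simp add: nu_def n_def)
  qed
  have n_total: "(\<Sum>t\<in>UNIV. n x t) = real (card G)" for x
    using n_sum[of "\<lambda>_. 1" x] by simp
  have g_total: "(\<Sum>t\<in>UNIV. g x t) = 0" for x
    by (simp add: g_def sum_subtractf n_total)
  \<comment> \<open>The constant part of one factor \<open>g x t\<close> drops out because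
    \<open>g x\<close> sums to zero; the remaining count \<open>n x t\<close> turns the sum over
    \<open>t\<close> into one over \<open>G\<close>.\<close>
  have s_eq: "s x = (\<Sum>y\<in>G. g x (dot_prod x y))" for x
  proof -
    have "s x = (\<Sum>t\<in>UNIV. g x t * n x t - real (card G) / ?N * g x t)"
      unfolding s_def by (intro sum.cong refl) (simp add: g_def power2_eq_square algebra_simps)
    also have "\<dots> = (\<Sum>t\<in>UNIV. g x t * n x t) - real (card G) / ?N * (\<Sum>t\<in>UNIV. g x t)"
      by (simp only: sum_subtractf sum_distrib_left)
    finally show ?thesis by (simp add: g_total n_sum)
  qed
  have norm: "(\<Sum>y\<in>UNIV. (g x (dot_prod x y))\<^sup>2) = Q * s x" if x: "x \<in> F" for x
  proof -
    obtain j where "x $ j \<in> units"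
      using F x by (auto simp: nonunit_vectors_def nonunits_def)
    then show ?thesis unfolding s_def Q_def by (rule sum_dot_prod)
  qed
  have corr: "(\<Sum>y\<in>UNIV. g x (dot_prod x y) * g x' (dot_prod x' y))
      \<le> (if minors_nonunit x x' then Q * (s x + s x') / 2 else 0)"
    if x: "x \<in> F" and x': "x' \<in> F" for x x'
  proof (cases "minors_nonunit x x'")
    case True
    have "g x (dot_prod x y) * g x' (dot_prod x' y)
        \<le> ((g x (dot_prod x y))\<^sup>2 + (g x' (dot_prod x' y))\<^sup>2) / 2" for y
      using sum_squares_bound[of "g x (dot_prod x y)" "g x' (dot_prod x' y)"] by simp
    then have "(\<Sum>y\<in>UNIV. g x (dot_prod x y) * g x' (dot_prod x' y))
        \<le> (\<Sum>y\<in>UNIV. ((g x (dot_prod x y))\<^sup>2 + (g x' (dot_prod x' y))\<^sup>2) / 2)"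
      by (intro sum_mono)
    also have "\<dots> = Q * (s x + s x') / 2"
      by (simp add: sum.distrib norm x x' distrib_left flip: sum_divide_distrib)
    finally show ?thesis using True by simp
  qed (simp add: dot_prod_correlation_zero g_total)
  have s0: "s x \<ge> 0" for x by (simp add: s_def sum_nonneg)
  have Q0: "Q \<ge> 0" by (simp add: Q_def)
  \<comment> \<open>Schur's test: \<open>K\<close> bounds the row sums of the 0-1 matrix of
    dependent pairs, and by symmetry of the minors also its column sums.\<close>
  have half: "(\<Sum>x\<in>F. \<Sum>x'\<in>F. if minors_nonunit x x' then s x else 0) \<le> K * A"
  proof -
    have "(\<Sum>x'\<in>F. if minors_nonunit x x' then s x else 0)
        = real (card {x' \<in> F. minors_nonunit x x'}) * s x" for x
      by (simp add: sum.If_cases Int_def)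
    then show ?thesis
      unfolding A_def sum_distrib_left using K s0 by (simp add: sum_mono mult_right_mono)
  qed
  have "(\<Sum>x\<in>F. \<Sum>x'\<in>F. if minors_nonunit x x' then s x' else 0)
      = (\<Sum>x'\<in>F. \<Sum>x\<in>F. if minors_nonunit x' x then s x' else 0)"
    by (subst sum.swap) (simp add: minors_nonunit_commute)
  then have half': "(\<Sum>x\<in>F. \<Sum>x'\<in>F. if minors_nonunit x x' then s x' else 0) \<le> K * A"
    using half by simp
  have "(\<Sum>y\<in>UNIV. (\<Sum>x\<in>F. g x (dot_prod x y))\<^sup>2)
      = (\<Sum>y\<in>UNIV. \<Sum>x\<in>F. \<Sum>x'\<in>F. g x (dot_prod x y) * g x' (dot_prod x' y))"
    by (simp add: power2_eq_square sum_product)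
  also have "\<dots> = (\<Sum>x\<in>F. \<Sum>y\<in>UNIV. \<Sum>x'\<in>F. g x (dot_prod x y) * g x' (dot_prod x' y))"
    by (rule sum.swap)
  also have "\<dots> = (\<Sum>x\<in>F. \<Sum>x'\<in>F. \<Sum>y\<in>UNIV. g x (dot_prod x y) * g x' (dot_prod x' y))"
    by (intro sum.cong refl sum.swap)
  also have "\<dots> \<le> (\<Sum>x\<in>F. \<Sum>x'\<in>F. if minors_nonunit x x' then Q * (s x + s x') / 2 else 0)"
    by (intro sum_mono corr)
  also have "\<dots> = (\<Sum>x\<in>F. \<Sum>x'\<in>F. Q / 2 * ((if minors_nonunit x x' then s x else 0)
      + (if minors_nonunit x x' then s x' else 0)))"
    by (intro sum.cong refl) simp
  also have "\<dots> = Q / 2 * ((\<Sum>x\<in>F. \<Sum>x'\<in>F. if minors_nonunit x x' then s x else 0)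
      + (\<Sum>x\<in>F. \<Sum>x'\<in>F. if minors_nonunit x x' then s x' else 0))"
    by (simp only: sum.distrib flip: sum_distrib_left)
  also have "\<dots> \<le> Q / 2 * (K * A + K * A)"
    using half half' Q0 by (intro mult_left_mono add_mono) auto
  finally have schur: "(\<Sum>y\<in>UNIV. (\<Sum>x\<in>F. g x (dot_prod x y))\<^sup>2) \<le> Q * K * A"
    by (simp add: mult_ac)
  have "A = (\<Sum>y\<in>G. \<Sum>x\<in>F. g x (dot_prod x y))"
    unfolding A_def s_eq by (rule sum.swap)
  then have "A\<^sup>2 \<le> real (card G) * (\<Sum>y\<in>G. (\<Sum>x\<in>F. g x (dot_prod x y))\<^sup>2)"
    using sum_squared_le_sum_of_squares[of "\<lambda>y. \<Sum>x\<in>F. g x (dot_prod x y)" G]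
    by (simp add: mult.commute)
  \<comment> \<open>Adding squares for \<open>y\<close> outside \<open>G\<close> makes the
    orthogonality over the whole module available.\<close>
  also have "\<dots> \<le> real (card G) * (\<Sum>y\<in>UNIV. (\<Sum>x\<in>F. g x (dot_prod x y))\<^sup>2)"
    by (intro mult_left_mono sum_mono2) auto
  also have "\<dots> \<le> real (card G) * (Q * K * A)"
    using schur by (rule mult_left_mono) simp
  finally have "A * A \<le> (real (card G) * Q * K) * A"
    by (simp add: power2_eq_square mult.assoc)
  moreover have "A \<ge> 0" unfolding A_def by (intro sum_nonneg s0)
  ultimately have A_le: "A \<le> real (card G) * Q * K"
    using Q0 K0 by (cases "A = 0") auto
  have nu_g: "real (nu F G t) - real (card F) * real (card G) / ?N = (\<Sum>x\<in>F. g x t)" for t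
    by (simp add: nu_eq g_def sum_subtractf)
  have nu_total: "(\<Sum>t\<in>UNIV. real (nu F G t)) = real (card F) * real (card G)"
    unfolding nu_eq by (subst sum.swap) (simp add: n_total)
  \<comment> \<open>Variance identity: the mean of \<open>nu F G\<close> is |F||G|/|R|, so the sum
    of squared deviations is the second moment minus the main term.\<close>
  have "(\<Sum>t\<in>UNIV. (real (nu F G t) - real (card F) * real (card G) / ?N)\<^sup>2)
      = (\<Sum>t\<in>UNIV. (real (nu F G t))\<^sup>2 - 2 * (real (card F) * real (card G) / ?N) * real (nu F G t)
          + (real (card F) * real (card G) / ?N)\<^sup>2)"
    by (intro sum.cong refl) (simp add: power2_diff algebra_simps)
  also have "\<dots> = (\<Sum>t\<in>UNIV. (real (nu F G t))\<^sup>2)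
      - 2 * (real (card F) * real (card G) / ?N) * (real (card F) * real (card G))
      + ?N * (real (card F) * real (card G) / ?N)\<^sup>2"
    by (simp only: sum.distrib sum_subtractf nu_total sum_constant flip: sum_distrib_left)
  also have "\<dots> = (\<Sum>t\<in>UNIV. (real (nu F G t))\<^sup>2) - (real (card F))\<^sup>2 * (real (card G))\<^sup>2 / ?N"
    using N0 by (simp add: power2_eq_square)
  finally have "(\<Sum>t\<in>UNIV. (real (nu F G t))\<^sup>2) - (real (card F))\<^sup>2 * (real (card G))\<^sup>2 / ?N
      = (\<Sum>t\<in>UNIV. (\<Sum>x\<in>F. g x t)\<^sup>2)"
    by (simp add: nu_g)
  also have "\<dots> \<le> (\<Sum>t\<in>UNIV. real (card F) * (\<Sum>x\<in>F. (g x t)\<^sup>2))"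
  proof (rule sum_mono)
    fix t
    show "(\<Sum>x\<in>F. g x t)\<^sup>2 \<le> real (card F) * (\<Sum>x\<in>F. (g x t)\<^sup>2)"
      using sum_squared_le_sum_of_squares[of "\<lambda>x. g x t" F] by (simp add: mult.commute)
  qed
  also have "\<dots> = real (card F) * A"
    unfolding A_def s_def by (subst sum.swap[of _ UNIV]) (simp add: sum_distrib_left)
  also have "\<dots> \<le> real (card F) * (real (card G) * Q * K)"
    using A_le by (intro mult_left_mono) auto
  finally show ?thesis by (simp add: Q_def mult.assoc)
qed

theorem theorem2p5:
  fixes F G :: "('a::finite_valuation_ring ^ 'd::finite) set"
    and q r :: nat
  assumes "primepow q" and "odd q"
    and "card (residue_field :: 'a set set) = q"
    and "CARD('a) = q ^ r"
    and "F \<inter> nonunit_vectors = {}"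
  shows "(\<Sum>t\<in>UNIV. (real (nu F G t))\<^sup>2)
    \<le> (real (card F))\<^sup>2 * (real (card G))\<^sup>2 / real q ^ r
      + real q ^ ((CARD('d) - 1) * (2 * r - 1)) * real (card F) * real (card G)
        * real (MAX x\<in>UNIV - nonunit_vectors. card (F \<inter> unit_line x))"
proof -
  let ?M = "MAX x\<in>UNIV - nonunit_vectors. card (F \<inter> unit_line x)"
  let ?d = "CARD('d) - 1"
  have q0: "q > 0" using assms(1) by (rule primepow_gt_0_nat)
  \<comment> \<open>As 0 and 1 differ, \<open>r\<close> is positive, so \<open>2 * r - 1\<close> is
    not truncated.\<close>
  have "card {0, 1 :: 'a} \<le> CARD('a)" by (intro card_mono) auto
  then obtain k where r: "r = Suc k" using assms(4) by (cases r) auto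
  have "card (nonunits :: 'a set) = q ^ k"
    using card_eq_residue_mult_nonunits[where 'a = 'a] assms(3,4) q0 r by simp
  then have "real (card {x' \<in> F. minors_nonunit x x'}) \<le> real q ^ (k * ?d) * real ?M"
    if "x \<in> F" for x
    using of_nat_mono[OF card_minors_nonunit_le[OF assms(5) that], where 'a = real]
    by (simp add: power_mult)
  then have "(\<Sum>t\<in>UNIV. (real (nu F G t))\<^sup>2)
      \<le> (real (card F))\<^sup>2 * (real (card G))\<^sup>2 / real CARD('a)
        + real (card F) * real (card G) * real CARD('a) ^ ?d * (real q ^ (k * ?d) * real ?M)"
    by (intro sum_nu_sq_le assms(5))
  also have "real CARD('a) = real q ^ r" by (simp add: assms(4))
  also have "real (card F) * real (card G) * (real q ^ r) ^ ?d * (real q ^ (k * ?d) * real ?M)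
      = real q ^ (r * ?d + k * ?d) * real (card F) * real (card G) * real ?M"
    by (simp add: power_add power_mult)
  \<comment> \<open>The part \<open>r * ?d\<close> comes from the fibre size of the dot product,
    \<open>k * ?d\<close> from the number of unit lines.\<close>
  also have "r * ?d + k * ?d = ?d * (r + k)"
    by (simp only: distrib_right mult.commute[of ?d])
  also have "r + k = 2 * r - 1"
    by (simp add: r)
  finally show ?thesis .
qed

end
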